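(* Let $p\in S^3\subset\mathbb{C}^2$, $v\in T_pS^3$, let $\gamma_R$ be the great circle with $\gamma_R(0)=p$, $\dot\gamma_R(0)=v$, and suppose that the sub-Riemannian geodesic $$\gamma(t)=e^{-i\langle v,V_2(p)\rangle t}\,\gamma_R(t)$$ is parameterized by arc-length. Then the curvature of $\gamma$ equals $\langle v,V_2(p)\rangle$; that is, $$\nabla_{\dot\gamma}\dot\gamma+2\lambda J(\dot\gamma)=0\quad\text{with}\quad \lambda=\langle v,V_2(p)\rangle .$$
   Context: $S^3$ is the unit sphere of $\mathbb{C}^2\cong\mathbb{R}^4$ with the standard inner product $\langle\cdot,\cdot\rangle$ and the induced round metric; $\nabla$ is its Levi-Civita connection. $V_2(p)=i\cdot p$ (componentwise multiplication by $i$). The horizontal distribution $\mathcal H$ is the orthogonal complement of $V_2$ in $TS^3$, with the restricted metric, and $J:\mathcal H\to\mathcal H$ is the standard almost complex structure, i.e. multiplication by $i$ in $\mathbb{C}^2$. The curve $\gamma$ is horizontal, so $\dot\gamma\in\mathcal H$. A $C^2$ horizontal curve $\gamma$ parameterized by arc-length is said to have curvature $\lambda\in\mathbb{R}$ if $\nabla_{\dot\gamma}\dot\gamma+2\lambda J(\dot\gamma)=0$. *)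

theory Defs
  imports "HOL-Analysis.Analysis"
begin

text \<open>
  Points and tangent vectors of the sphere are elements of \<^typ>\<open>complex^2\<close>. The library inner product
  of this type is the real one, i.e. the standard inner product of \<open>\<real>\<^sup>4\<close>; the round metric is its
  restriction to the tangent spaces. Functions and vector fields on the sphere are represented by total
  functions of which only the values on the sphere are relevant.
\<close>

definition S3 :: "(complex^2) set"
  where "S3 = sphere 0 1"

definition tangent_space :: "complex^2 \<Rightarrow> (complex^2) set"
  where "tangent_space p = {v. v \<bullet> p = 0}"

definition V2 :: "complex^2 \<Rightarrow> complex^2"
  where "V2 p = \<i> *s p"

definition horizontal_space :: "complex^2 \<Rightarrow> (complex^2) set"
  where "horizontal_space p = {v \<in> tangent_space p. v \<bullet> V2 p = 0}"

definition J :: "complex^2 \<Rightarrow> complex^2"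
  where "J v = \<i> *s v"


section \<open>Smooth functions and vector fields on the sphere\<close>

text \<open>
  A derivative within \<^const>\<open>S3\<close> is determined only on tangent vectors, so \<open>f'\<close> below is one of many
  choices. Its restriction to the tangent spaces is the differential of \<open>f\<close> on the manifold.
\<close>

primrec Ck_on :: "nat \<Rightarrow> 'a::real_normed_vector set \<Rightarrow> ('a \<Rightarrow> 'b::real_normed_vector) \<Rightarrow> bool"
  where
    "Ck_on 0 S f \<longleftrightarrow> continuous_on S f"
  | "Ck_on (Suc k) S f \<longleftrightarrow>
      (\<exists>f'. (\<forall>x\<in>S. (f has_derivative f' x) (at x within S)) \<and> (\<forall>v. Ck_on k S (\<lambda>x. f' x v)))"

definition smooth_on_S3 :: "(complex^2 \<Rightarrow> 'b::real_normed_vector) \<Rightarrow> bool"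
  where "smooth_on_S3 f \<longleftrightarrow> (\<forall>k. Ck_on k S3 f)"

definition vector_field :: "(complex^2 \<Rightarrow> complex^2) \<Rightarrow> bool"
  where "vector_field X \<longleftrightarrow> smooth_on_S3 X \<and> (\<forall>p\<in>S3. X p \<in> tangent_space p)"

text \<open>The value is independent of the choice made by \<^const>\<open>frechet_derivative\<close> if \<open>u\<close> is tangent at \<open>p\<close>.\<close>

definition dir_deriv :: "(complex^2 \<Rightarrow> 'b::real_normed_vector) \<Rightarrow> complex^2 \<Rightarrow> complex^2 \<Rightarrow> 'b"
  where "dir_deriv f p u = frechet_derivative f (at p within S3) u"

definition lie_bracket :: "(complex^2 \<Rightarrow> complex^2) \<Rightarrow> (complex^2 \<Rightarrow> complex^2) \<Rightarrow> complex^2 \<Rightarrow> complex^2"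
  where "lie_bracket X Y p = dir_deriv Y p (X p) - dir_deriv X p (Y p)"


section \<open>The Levi-Civita connection and the covariant derivative along a curve\<close>

type_synonym connection = "(complex^2 \<Rightarrow> complex^2) \<Rightarrow> (complex^2 \<Rightarrow> complex^2) \<Rightarrow> complex^2 \<Rightarrow> complex^2"

definition affine_connection :: "connection \<Rightarrow> bool"
  where "affine_connection nabla \<longleftrightarrow>
    (\<forall>X Y. vector_field X \<longrightarrow> vector_field Y \<longrightarrow> vector_field (nabla X Y)) \<and>
    (\<forall>X X' Y. vector_field X \<longrightarrow> vector_field X' \<longrightarrow> vector_field Y \<longrightarrow>
      (\<forall>p\<in>S3. nabla (\<lambda>q. X q + X' q) Y p = nabla X Y p + nabla X' Y p)) \<and>
    (\<forall>f X Y. smooth_on_S3 (f :: complex^2 \<Rightarrow> real) \<longrightarrow> vector_field X \<longrightarrow> vector_field Y \<longrightarrow>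
      (\<forall>p\<in>S3. nabla (\<lambda>q. f q *\<^sub>R X q) Y p = f p *\<^sub>R nabla X Y p)) \<and>
    (\<forall>X Y Y'. vector_field X \<longrightarrow> vector_field Y \<longrightarrow> vector_field Y' \<longrightarrow>
      (\<forall>p\<in>S3. nabla X (\<lambda>q. Y q + Y' q) p = nabla X Y p + nabla X Y' p)) \<and>
    (\<forall>f X Y. smooth_on_S3 (f :: complex^2 \<Rightarrow> real) \<longrightarrow> vector_field X \<longrightarrow> vector_field Y \<longrightarrow>
      (\<forall>p\<in>S3. nabla X (\<lambda>q. f q *\<^sub>R Y q) p = dir_deriv f p (X p) *\<^sub>R Y p + f p *\<^sub>R nabla X Y p))"

definition is_levi_civita :: "connection \<Rightarrow> bool"
  where "is_levi_civita nabla \<longleftrightarrow> affine_connection nabla \<and>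
    (\<forall>X Y. vector_field X \<longrightarrow> vector_field Y \<longrightarrow>
      (\<forall>p\<in>S3. nabla X Y p - nabla Y X p = lie_bracket X Y p)) \<and>
    (\<forall>X Y Z. vector_field X \<longrightarrow> vector_field Y \<longrightarrow> vector_field Z \<longrightarrow>
      (\<forall>p\<in>S3. dir_deriv (\<lambda>q. Y q \<bullet> Z q) p (X p) = nabla X Y p \<bullet> Z p + Y p \<bullet> nabla X Z p))"

text \<open>
  The connection is unique only as far as its values for vector fields and at points of the sphere are
  concerned, so it is introduced by \<open>SOME\<close> rather than by \<open>THE\<close>.
\<close>

definition levi_civita :: connection
  where "levi_civita = (SOME nabla. is_levi_civita nabla)"

definition velocity :: "(real \<Rightarrow> complex^2) \<Rightarrow> real \<Rightarrow> complex^2"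
  where "velocity \<gamma> t = vector_derivative \<gamma> (at t)"

definition vector_field_along :: "(real \<Rightarrow> complex^2) \<Rightarrow> (real \<Rightarrow> complex^2) \<Rightarrow> bool"
  where "vector_field_along \<gamma> W \<longleftrightarrow>
    W C1_differentiable_on UNIV \<and> (\<forall>t. W t \<in> tangent_space (\<gamma> t))"

text \<open>
  The covariant derivative along \<open>\<gamma>\<close> induced by a connection is the operator on vector fields along \<open>\<gamma>\<close>
  that is additive, satisfies the Leibniz rule, and sends the restriction of a vector field \<open>Y\<close> of the
  sphere to the covariant derivative of \<open>Y\<close> in direction of the velocity.
\<close>

definition is_cov_deriv_along ::
    "connection \<Rightarrow> (real \<Rightarrow> complex^2) \<Rightarrow> ((real \<Rightarrow> complex^2) \<Rightarrow> real \<Rightarrow> complex^2) \<Rightarrow> bool"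
  where "is_cov_deriv_along nabla \<gamma> D \<longleftrightarrow>
    (\<forall>W. vector_field_along \<gamma> W \<longrightarrow> (\<forall>t. D W t \<in> tangent_space (\<gamma> t))) \<and>
    (\<forall>W W'. vector_field_along \<gamma> W \<longrightarrow> vector_field_along \<gamma> W' \<longrightarrow>
      (\<forall>t. D (\<lambda>s. W s + W' s) t = D W t + D W' t)) \<and>
    (\<forall>f W. (f :: real \<Rightarrow> real) C1_differentiable_on UNIV \<longrightarrow> vector_field_along \<gamma> W \<longrightarrow>
      (\<forall>t. D (\<lambda>s. f s *\<^sub>R W s) t = deriv f t *\<^sub>R W t + f t *\<^sub>R D W t)) \<and>
    (\<forall>X Y t. vector_field X \<longrightarrow> vector_field Y \<longrightarrow> X (\<gamma> t) = velocity \<gamma> t \<longrightarrow>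
      D (Y \<circ> \<gamma>) t = nabla X Y (\<gamma> t))"

definition cov_deriv_along :: "(real \<Rightarrow> complex^2) \<Rightarrow> (real \<Rightarrow> complex^2) \<Rightarrow> real \<Rightarrow> complex^2"
  where "cov_deriv_along \<gamma> = (SOME D. is_cov_deriv_along levi_civita \<gamma> D)"


section \<open>Curves\<close>

text \<open>
  Great circles with a constant speed parameterization. The case \<open>\<omega> = 0\<close> is the constant curve, which
  is the geodesic with initial velocity zero.
\<close>

definition great_circle :: "(real \<Rightarrow> complex^2) \<Rightarrow> bool"
  where "great_circle c \<longleftrightarrow>
    (\<exists>u w \<omega>. norm u = 1 \<and> norm w = 1 \<and> u \<bullet> w = 0 \<and>
      (\<forall>t. c t = cos (\<omega> * t) *\<^sub>R u + sin (\<omega> * t) *\<^sub>R w))"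

definition C2_curve_in_S3 :: "(real \<Rightarrow> complex^2) \<Rightarrow> bool"
  where "C2_curve_in_S3 \<gamma> \<longleftrightarrow> range \<gamma> \<subseteq> S3 \<and>
    \<gamma> C1_differentiable_on UNIV \<and> velocity \<gamma> C1_differentiable_on UNIV"

definition horizontal_curve :: "(real \<Rightarrow> complex^2) \<Rightarrow> bool"
  where "horizontal_curve \<gamma> \<longleftrightarrow> (\<forall>t. velocity \<gamma> t \<in> horizontal_space (\<gamma> t))"

definition arc_length_parameterized :: "(real \<Rightarrow> complex^2) \<Rightarrow> bool"
  where "arc_length_parameterized \<gamma> \<longleftrightarrow> (\<forall>t. norm (velocity \<gamma> t) = 1)"

definition has_curvature :: "(real \<Rightarrow> complex^2) \<Rightarrow> real \<Rightarrow> bool"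
  where "has_curvature \<gamma> \<kappa> \<longleftrightarrow>
    C2_curve_in_S3 \<gamma> \<and> horizontal_curve \<gamma> \<and> arc_length_parameterized \<gamma> \<and>
    (\<forall>t. cov_deriv_along \<gamma> (velocity \<gamma>) t + (2 * \<kappa>) *\<^sub>R J (velocity \<gamma> t) = 0)"

end

theory Submission
  imports Defs
begin

text \<open>
  The Levi-Civita connection of the round sphere is the tangential part of the ambient derivative, so
  the covariant derivative along a curve \<open>\<gamma>\<close> in the sphere sends \<open>W\<close> to \<open>W' - (W' \<bullet> \<gamma>) \<gamma>\<close>. Write
  \<open>c = \<gamma>\<^sub>R\<close>, with \<open>c'' = - \<omega>\<^sup>2 c\<close>, and \<open>\<mu> = v \<bullet> V2 p\<close>. The number \<open>c' \<bullet> i c\<close> is constant along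
  the great circle, hence equal to \<open>\<mu>\<close>. Differentiating \<open>\<gamma> = e\<^bsup>-i\<mu>t\<^esup> c\<close> twice gives
  \<open>\<gamma>' = e\<^bsup>-i\<mu>t\<^esup> (c' - \<mu> i c)\<close>, which is therefore horizontal, and
  \<open>\<gamma>'' = (\<mu>\<^sup>2 - \<omega>\<^sup>2) \<gamma> - 2 \<mu> i \<gamma>'\<close>, whose tangential part is \<open>- 2 \<mu> J \<gamma>'\<close>.
\<close>


section \<open>Calculus of \<open>C\<^sup>k\<close> maps\<close>

lemma Ck_on_cong:
  assumes "Ck_on k S f" "\<And>x. x \<in> S \<Longrightarrow> f x = g x"
  shows "Ck_on k S g"
proof (cases k)
  case 0
  with assms show ?thesis
    by (metis Ck_on.simps(1) continuous_on_cong)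
next
  case (Suc n)
  with assms(1) obtain f' where f': "\<And>x. x \<in> S \<Longrightarrow> (f has_derivative f' x) (at x within S)"
    "\<And>v. Ck_on n S (\<lambda>x. f' x v)" by auto
  have "(g has_derivative f' x) (at x within S)" if "x \<in> S" for x
    using has_derivative_transform[OF that _ f'(1)[OF that]] assms(2) by metis
  with f'(2) Suc show ?thesis by auto
qed

lemma Ck_on_Suc_imp_Ck_on: "Ck_on (Suc k) S f \<Longrightarrow> Ck_on k S f"
proof (induction k arbitrary: f)
  case 0
  then show ?case
    using has_derivative_continuous_on by fastforce
next
  case (Suc k)
  then show ?case
    by (metis Ck_on.simps(2))
qed

lemma Ck_on_const [simp]: "Ck_on k S (\<lambda>x. c)"
proof (induction k arbitrary: c)
  case (Suc k)
  then show ?case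
    by (auto intro!: exI[of _ "\<lambda>x v. 0"])
qed simp

lemma Ck_on_ident [simp]: "Ck_on k S (\<lambda>x. x)"
proof (cases k)
  case (Suc n)
  then show ?thesis
    by (auto intro!: exI[of _ "\<lambda>x v. v"])
qed simp

lemma Ck_on_add:
  "Ck_on k S f \<Longrightarrow> Ck_on k S g \<Longrightarrow> Ck_on k S (\<lambda>x. f x + g x)"
proof (induction k arbitrary: f g)
  case 0
  then show ?case by (simp add: continuous_on_add)
next
  case (Suc k)
  obtain f' where f': "\<And>x. x \<in> S \<Longrightarrow> (f has_derivative f' x) (at x within S)"
    "\<And>v. Ck_on k S (\<lambda>x. f' x v)" using Suc.prems(1) by auto
  obtain g' where g': "\<And>x. x \<in> S \<Longrightarrow> (g has_derivative g' x) (at x within S)"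
    "\<And>v. Ck_on k S (\<lambda>x. g' x v)" using Suc.prems(2) by auto
  show ?case
    unfolding Ck_on.simps
  proof (intro exI conjI ballI allI)
    show "((\<lambda>x. f x + g x) has_derivative (\<lambda>v. f' x v + g' x v)) (at x within S)" if "x \<in> S" for x
      using f'(1) g'(1) that by (intro has_derivative_add)
    show "Ck_on k S (\<lambda>x. f' x v + g' x v)" for v
      using Suc.IH f'(2) g'(2) by blast
  qed
qed

lemma Ck_on_sum:
  "(\<And>i. i \<in> I \<Longrightarrow> Ck_on k S (f i)) \<Longrightarrow> Ck_on k S (\<lambda>x. \<Sum>i\<in>I. f i x)"
  by (induction I rule: infinite_finite_induct) (auto intro: Ck_on_add)

text \<open>One induction serves inner products and scalar multiples alike: the product rule
  produces sums of products of the same kind, with the undifferentiated factors used one order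
  lower.\<close>

lemma (in bounded_bilinear) Ck_on:
  "Ck_on k S f \<Longrightarrow> Ck_on k S g \<Longrightarrow> Ck_on k S (\<lambda>x. prod (f x) (g x))"
proof (induction k arbitrary: f g)
  case 0
  then show ?case by (simp add: continuous_on)
next
  case (Suc k)
  obtain f' where f': "\<And>x. x \<in> S \<Longrightarrow> (f has_derivative f' x) (at x within S)"
    "\<And>v. Ck_on k S (\<lambda>x. f' x v)" using Suc.prems(1) by auto
  obtain g' where g': "\<And>x. x \<in> S \<Longrightarrow> (g has_derivative g' x) (at x within S)"
    "\<And>v. Ck_on k S (\<lambda>x. g' x v)" using Suc.prems(2) by auto
  show ?case
    unfolding Ck_on.simps
  proof (intro exI conjI ballI allI)
    show "((\<lambda>x. prod (f x) (g x)) has_derivative (\<lambda>v. prod (f x) (g' x v) + prod (f' x v) (g x)))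
        (at x within S)" if "x \<in> S" for x
      using f'(1) g'(1) that by (intro FDERIV)
    show "Ck_on k S (\<lambda>x. prod (f x) (g' x v) + prod (f' x v) (g x))" for v
      using Suc.IH f'(2) g'(2) Suc.prems[THEN Ck_on_Suc_imp_Ck_on] by (intro Ck_on_add) blast+
  qed
qed

lemmas Ck_on_inner = bounded_bilinear.Ck_on[OF bounded_bilinear_inner]
lemmas Ck_on_scaleR = bounded_bilinear.Ck_on[OF bounded_bilinear_scaleR]

lemma Ck_on_diff:
  assumes "Ck_on k S f" "Ck_on k S g"
  shows "Ck_on k S (\<lambda>x. f x - g x)"
  using Ck_on_add[OF assms(1) Ck_on_scaleR[OF Ck_on_const[of k S "-1"] assms(2)]] by simp


section \<open>Directional derivatives on the sphere\<close>

lemma inner_self_S3: "p \<in> S3 \<Longrightarrow> p \<bullet> p = 1"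
  by (simp add: S3_def dot_square_norm)

lemma smooth_on_S3_has_derivative:
  assumes "smooth_on_S3 f" "p \<in> S3"
  shows "(f has_derivative frechet_derivative f (at p within S3)) (at p within S3)"
proof -
  have "Ck_on (Suc 0) S3 f"
    using assms(1) unfolding smooth_on_S3_def by blast
  then show ?thesis
    using assms(2) by (auto simp: frechet_derivative_works[symmetric] differentiable_def)
qed

text \<open>A derivative within \<open>S3\<close> is enough for the chain rule because the curve
  never leaves \<open>S3\<close>. Any admissible \<open>f'\<close> may be used, which later allows
  two of them to be compared.\<close>

lemma has_vector_derivative_compose_S3:
  assumes "(f has_derivative f') (at (c t) within S3)" "range c \<subseteq> S3"
    and "(c has_vector_derivative d) (at t)"
  shows "((\<lambda>s. f (c s)) has_vector_derivative f' d) (at t)"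
proof -
  have "(f has_derivative f') (at (c t) within range c)"
    using assms(1,2) has_derivative_subset by blast
  then have "((f \<circ> c) has_derivative (f' \<circ> (\<lambda>h. h *\<^sub>R d))) (at t)"
    using assms(3) unfolding has_vector_derivative_def by (intro diff_chain_within) auto
  moreover have "f' \<circ> (\<lambda>h. h *\<^sub>R d) = (\<lambda>h. h *\<^sub>R f' d)"
    using assms(1) by (auto simp: o_def linear_cmul dest!: has_derivative_linear)
  ultimately show ?thesis
    by (simp add: has_vector_derivative_def o_def)
qed

lemma tangent_vector_is_velocity:
  assumes "p \<in> S3" "u \<in> tangent_space p"
  obtains c where "range c \<subseteq> S3" "c 0 = p" "(c has_vector_derivative u) (at 0)"
proof (cases "u = 0")
  case True
  with assms show ?thesis
    by (intro that[of "\<lambda>_. p"]) auto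
next
  case False
  define a where "a = norm u"
  have a: "a \<noteq> 0" using False by (simp add: a_def)
  \<comment> \<open>The great circle in the plane of \<open>p\<close> and \<open>u\<close> with
    angular speed \<open>norm u\<close>. Dividing by \<open>a\<close> normalises \<open>u\<close>,
    hence the separate case \<open>u = 0\<close>.\<close>
  define c where "c = (\<lambda>s. cos (a * s) *\<^sub>R p + (sin (a * s) / a) *\<^sub>R u)"
  have uu: "u \<bullet> u = a^2" and up: "u \<bullet> p = 0" "p \<bullet> u = 0" and pp: "p \<bullet> p = 1"
    using assms inner_self_S3 by (auto simp: a_def dot_square_norm tangent_space_def inner_commute)
  have "c s \<bullet> c s = 1" for s
    using a by (simp add: c_def inner_simps uu up pp power2_eq_square[symmetric])
  then have "range c \<subseteq> S3"
    by (auto simp: S3_def norm_eq_1)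
  moreover have "(c has_vector_derivative u) (at 0)"
    unfolding c_def using a by (auto intro!: derivative_eq_intros)
  ultimately show ?thesis
    by (intro that[of c]) (simp_all add: c_def)
qed

text \<open>Every derivative within \<open>S3\<close> yields the velocity of \<open>f\<close> along
  the same curve with velocity \<open>u\<close>, so all of them agree on tangent vectors.\<close>

lemma dir_deriv_eq:
  assumes "(f has_derivative f') (at p within S3)" "p \<in> S3" "u \<in> tangent_space p"
  shows "dir_deriv f p u = f' u"
proof -
  obtain c where c: "range c \<subseteq> S3" "c 0 = p" "(c has_vector_derivative u) (at 0)"
    using tangent_vector_is_velocity assms(2,3) by blast
  have "(f has_derivative frechet_derivative f (at p within S3)) (at p within S3)"
    using assms(1) by (auto simp: frechet_derivative_works[symmetric] differentiable_def)
  then have "((\<lambda>s. f (c s)) has_vector_derivative dir_deriv f p u) (at 0)"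
    using has_vector_derivative_compose_S3[of f _ c 0, OF _ c(1,3)] c(2) by (simp add: dir_deriv_def)
  moreover have "((\<lambda>s. f (c s)) has_vector_derivative f' u) (at 0)"
    using has_vector_derivative_compose_S3[of f _ c 0, OF _ c(1,3)] c(2) assms(1) by simp
  ultimately show ?thesis
    by (rule vector_derivative_unique_at)
qed

text \<open>The witness \<open>f'\<close> may depend on \<open>k\<close> and is regular only for a
  fixed direction. Expanding \<open>X\<close> in \<open>Basis\<close> reduces to fixed directions,
  and \<open>dir_deriv_eq\<close> identifies the result on \<open>S3\<close> for every
  \<open>k\<close>.\<close>

lemma smooth_on_S3_dir_deriv:
  assumes "smooth_on_S3 f" "vector_field X"
  shows "smooth_on_S3 (\<lambda>p. dir_deriv f p (X p))"
  unfolding smooth_on_S3_def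
proof
  fix k
  have "Ck_on (Suc k) S3 f"
    using assms(1) unfolding smooth_on_S3_def by blast
  then obtain f' where f': "\<And>x. x \<in> S3 \<Longrightarrow> (f has_derivative f' x) (at x within S3)"
    "\<And>v. Ck_on k S3 (\<lambda>x. f' x v)" by auto
  have X: "Ck_on k S3 X" "\<And>p. p \<in> S3 \<Longrightarrow> X p \<in> tangent_space p"
    using assms(2) by (auto simp: vector_field_def smooth_on_S3_def)
  have "Ck_on k S3 (\<lambda>p. \<Sum>b\<in>Basis. (X p \<bullet> b) *\<^sub>R f' p b)"
    using X(1) f'(2) by (intro Ck_on_sum Ck_on_scaleR Ck_on_inner) auto
  then show "Ck_on k S3 (\<lambda>p. dir_deriv f p (X p))"
  proof (rule Ck_on_cong)
    fix p assume p: "p \<in> S3"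
    have lin: "linear (f' p)"
      using f'(1)[OF p] has_derivative_linear by blast
    have "(\<Sum>b\<in>Basis. (X p \<bullet> b) *\<^sub>R f' p b) = f' p (\<Sum>b\<in>Basis. (X p \<bullet> b) *\<^sub>R b)"
      using lin by (simp add: linear_sum linear_cmul)
    then show "(\<Sum>b\<in>Basis. (X p \<bullet> b) *\<^sub>R f' p b) = dir_deriv f p (X p)"
      using dir_deriv_eq[OF f'(1)[OF p] p X(2)[OF p]] by (simp add: euclidean_representation)
  qed
qed

lemma (in bounded_bilinear) dir_deriv_S3:
  assumes "smooth_on_S3 f" "smooth_on_S3 g" "p \<in> S3" "u \<in> tangent_space p"
  shows "dir_deriv (\<lambda>q. prod (f q) (g q)) p u = prod (f p) (dir_deriv g p u) + prod (dir_deriv f p u) (g p)"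
  by (subst dir_deriv_eq[OF FDERIV[OF assms(1,2)[THEN smooth_on_S3_has_derivative, OF assms(3)]]
        assms(3,4)])
    (simp add: dir_deriv_def)

lemma dir_deriv_add:
  assumes "smooth_on_S3 f" "smooth_on_S3 g" "p \<in> S3" "u \<in> tangent_space p"
  shows "dir_deriv (\<lambda>q. f q + g q) p u = dir_deriv f p u + dir_deriv g p u"
  by (subst dir_deriv_eq[OF has_derivative_add[OF
          assms(1,2)[THEN smooth_on_S3_has_derivative, OF assms(3)]] assms(3,4)])
    (simp add: dir_deriv_def)

lemma linear_dir_deriv:
  assumes "smooth_on_S3 f" "p \<in> S3"
  shows "linear (dir_deriv f p)"
  using smooth_on_S3_has_derivative[OF assms] has_derivative_linear
  unfolding dir_deriv_def by blast

text \<open>Differentiating \<open>Y q \<bullet> q = 0\<close>: the second fundamental form of the sphere.\<close>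

lemma dir_deriv_vector_field_inner_base:
  assumes "vector_field Y" "p \<in> S3" "u \<in> tangent_space p"
  shows "dir_deriv Y p u \<bullet> p = - (Y p \<bullet> u)"
proof -
  have Y: "(Y has_derivative frechet_derivative Y (at p within S3)) (at p within S3)"
    using assms smooth_on_S3_has_derivative by (auto simp: vector_field_def)
  have "((\<lambda>q. Y q \<bullet> q) has_derivative
      (\<lambda>h. Y p \<bullet> h + frechet_derivative Y (at p within S3) h \<bullet> p)) (at p within S3)"
    by (rule has_derivative_inner[OF Y has_derivative_ident])
  then have "dir_deriv (\<lambda>q. Y q \<bullet> q) p u = Y p \<bullet> u + dir_deriv Y p u \<bullet> p"
    using dir_deriv_eq assms(2,3) unfolding dir_deriv_def[of Y] by blast
  moreover have "((\<lambda>q. Y q \<bullet> q) has_derivative (\<lambda>h. 0)) (at p within S3)"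
    by (rule has_derivative_transform[OF assms(2) _ has_derivative_const[of 0]])
      (use assms(1) in \<open>auto simp: vector_field_def tangent_space_def\<close>)
  then have "dir_deriv (\<lambda>q. Y q \<bullet> q) p u = 0"
    using dir_deriv_eq assms(2,3) by blast
  ultimately show ?thesis by simp
qed


section \<open>The Levi-Civita connection of the sphere\<close>

text \<open>For a unit vector \<open>p\<close> this is the orthogonal projection onto
  \<open>tangent_space p\<close>.\<close>

definition tan_proj :: "complex^2 \<Rightarrow> complex^2 \<Rightarrow> complex^2"
  where "tan_proj p w = w - (w \<bullet> p) *\<^sub>R p"

lemma tan_proj_in_tangent_space: "p \<in> S3 \<Longrightarrow> tan_proj p w \<in> tangent_space p"
  by (simp add: tan_proj_def tangent_space_def inner_simps inner_self_S3)

lemma tan_proj_id: "w \<in> tangent_space p \<Longrightarrow> tan_proj p w = w"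
  by (simp add: tan_proj_def tangent_space_def)

lemma tan_proj_add: "tan_proj p (v + w) = tan_proj p v + tan_proj p w"
  by (simp add: tan_proj_def algebra_simps inner_simps)

lemma tan_proj_diff: "tan_proj p (v - w) = tan_proj p v - tan_proj p w"
  by (simp add: tan_proj_def algebra_simps inner_simps)

lemma tan_proj_scaleR: "tan_proj p (c *\<^sub>R w) = c *\<^sub>R tan_proj p w"
  by (simp add: tan_proj_def algebra_simps)

lemma inner_tan_proj: "v \<in> tangent_space p \<Longrightarrow> tan_proj p w \<bullet> v = w \<bullet> v"
  by (simp add: tan_proj_def tangent_space_def inner_simps inner_commute)

lemma vector_field_tan_proj:
  assumes "smooth_on_S3 f"
  shows "vector_field (\<lambda>q. tan_proj q (f q))"
  using assms unfolding vector_field_def smooth_on_S3_def tan_proj_def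
  by (auto intro!: Ck_on_diff Ck_on_scaleR Ck_on_inner
      tan_proj_in_tangent_space[unfolded tan_proj_def])

lemma vector_field_diff:
  assumes "vector_field X" "vector_field Y"
  shows "vector_field (\<lambda>q. X q - Y q)"
  using assms by (auto simp: vector_field_def smooth_on_S3_def tangent_space_def inner_simps
      intro: Ck_on_diff)

text \<open>The existence witness for the \<open>SOME\<close> in \<open>levi_civita\<close>.\<close>

definition proj_connection :: connection
  where "proj_connection X Y p = tan_proj p (dir_deriv Y p (X p))"

lemma affine_connection_proj_connection: "affine_connection proj_connection"
  unfolding affine_connection_def
proof (intro conjI allI impI ballI)
  fix X Y assume XY: "vector_field X" "vector_field Y"
  show "vector_field (proj_connection X Y)"
    using vector_field_tan_proj[OF smooth_on_S3_dir_deriv[OF _ XY(1), of Y]] XY(2)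
    unfolding proj_connection_def[abs_def] by (simp add: vector_field_def)
next
  fix X X' Y p
  assume "vector_field X" "vector_field X'" "vector_field Y" "p \<in> S3"
  then show "proj_connection (\<lambda>q. X q + X' q) Y p = proj_connection X Y p + proj_connection X' Y p"
    by (simp add: proj_connection_def vector_field_def linear_dir_deriv linear_add tan_proj_add)
next
  fix f :: "complex^2 \<Rightarrow> real" and X Y p
  assume "smooth_on_S3 f" "vector_field X" "vector_field Y" "p \<in> S3"
  then show "proj_connection (\<lambda>q. f q *\<^sub>R X q) Y p = f p *\<^sub>R proj_connection X Y p"
    by (simp add: proj_connection_def vector_field_def linear_dir_deriv linear_cmul tan_proj_scaleR)
next
  fix X Y Y' p
  assume "vector_field X" "vector_field Y" "vector_field Y'" "p \<in> S3"
  then show "proj_connection X (\<lambda>q. Y q + Y' q) p = proj_connection X Y p + proj_connection X Y' p"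
    by (simp add: proj_connection_def vector_field_def dir_deriv_add tan_proj_add)
next
  fix f :: "complex^2 \<Rightarrow> real" and X Y p
  assume "smooth_on_S3 f" "vector_field X" "vector_field Y" "p \<in> S3"
  then show "proj_connection X (\<lambda>q. f q *\<^sub>R Y q) p =
      dir_deriv f p (X p) *\<^sub>R Y p + f p *\<^sub>R proj_connection X Y p"
    by (simp add: proj_connection_def vector_field_def tan_proj_add tan_proj_scaleR tan_proj_id
        bounded_bilinear.dir_deriv_S3[OF bounded_bilinear_scaleR])
qed

text \<open>Torsion vanishes because the bracket is already tangent, so projecting does not change
  it. Metric compatibility holds because the discarded normal parts are orthogonal to the tangent
  vectors they are paired with.\<close>

lemma is_levi_civita_proj_connection: "is_levi_civita proj_connection"
  unfolding is_levi_civita_def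
proof (intro conjI allI impI ballI)
  show "affine_connection proj_connection"
    by (rule affine_connection_proj_connection)
next
  fix X Y p assume *: "vector_field X" "vector_field Y" "p \<in> S3"
  \<comment> \<open>The normal components of the two derivatives are both
    \<open>- (X p \<bullet> Y p)\<close> and cancel.\<close>
  then have "lie_bracket X Y p \<in> tangent_space p"
    using dir_deriv_vector_field_inner_base[of Y p "X p"] dir_deriv_vector_field_inner_base[of X p "Y p"]
    by (simp add: lie_bracket_def tangent_space_def inner_simps vector_field_def inner_commute)
  then show "proj_connection X Y p - proj_connection Y X p = lie_bracket X Y p"
    using tan_proj_id by (simp add: proj_connection_def lie_bracket_def flip: tan_proj_diff)
next
  fix X Y Z p assume "vector_field X" "vector_field Y" "vector_field Z" "p \<in> S3"
  then show "dir_deriv (\<lambda>q. Y q \<bullet> Z q) p (X p) =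
      proj_connection X Y p \<bullet> Z p + Y p \<bullet> proj_connection X Z p"
    by (simp add: proj_connection_def vector_field_def inner_tan_proj inner_commute[of "Y p"]
        bounded_bilinear.dir_deriv_S3[OF bounded_bilinear_inner])
qed

text \<open>
  The difference tensor of two Levi-Civita connections is symmetric in its first two slots and
  antisymmetric in its last two slots, hence zero.
\<close>

lemma is_levi_civita_unique:
  assumes n: "is_levi_civita n" and m: "is_levi_civita m"
    and XY: "vector_field X" "vector_field Y" and p: "p \<in> S3"
  shows "n X Y p = m X Y p"
proof -
  define T where "T = (\<lambda>X Y Z. (n X Y p - m X Y p) \<bullet> Z p)"
  have sym: "T X Y Z = T Y X Z" if "vector_field X" "vector_field Y" for X Y Z
  proof -
    have "n X Y p - n Y X p = m X Y p - m Y X p"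
      using n m that p unfolding is_levi_civita_def by simp
    then have "n X Y p - m X Y p = n Y X p - m Y X p"
      by (simp add: algebra_simps)
    then show ?thesis by (simp add: T_def)
  qed
  have anti: "T X Y Z = - T X Z Y" if "vector_field X" "vector_field Y" "vector_field Z" for X Y Z
  proof -
    have metric: "dir_deriv (\<lambda>q. Y q \<bullet> Z q) p (X p) = k X Y p \<bullet> Z p + Y p \<bullet> k X Z p"
      if "is_levi_civita k" for k
      using that \<open>vector_field X\<close> \<open>vector_field Y\<close> \<open>vector_field Z\<close> p
      unfolding is_levi_civita_def by blast
    have "n X Y p \<bullet> Z p + Y p \<bullet> n X Z p = m X Y p \<bullet> Z p + Y p \<bullet> m X Z p"
      using metric[OF n] metric[OF m] by simp
    then show ?thesis by (simp add: T_def inner_simps inner_commute)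
  qed
  \<comment> \<open>With this choice \<open>T X Y Z\<close> is the squared length of the difference
    of the connections at \<open>p\<close>.\<close>
  define Z where "Z = (\<lambda>q. n X Y q - m X Y q)"
  have Z: "vector_field Z"
    unfolding Z_def using n m XY
    by (intro vector_field_diff) (auto simp: is_levi_civita_def affine_connection_def)
  \<comment> \<open>Three antisymmetries alternating with three symmetries return to the same term
    with the opposite sign.\<close>
  have "T X Y Z = - T X Z Y" using anti XY Z by blast
  also have "T X Z Y = T Z X Y" using sym XY Z by blast
  also have "T Z X Y = - T Z Y X" using anti XY Z by blast
  also have "T Z Y X = T Y Z X" using sym XY Z by blast
  also have "T Y Z X = - T Y X Z" using anti XY Z by blast
  also have "T Y X Z = T X Y Z" using sym XY by blast
  finally have "T X Y Z = 0" by simp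
  then show ?thesis by (simp add: T_def Z_def)
qed

text \<open>Existence makes the chosen connection a Levi-Civita connection, and uniqueness then
  carries the explicit formula over to it.\<close>

lemma levi_civita_eq:
  assumes "vector_field X" "vector_field Y" "p \<in> S3"
  shows "levi_civita X Y p = tan_proj p (dir_deriv Y p (X p))"
proof -
  have "is_levi_civita levi_civita"
    unfolding levi_civita_def using is_levi_civita_proj_connection by (rule someI[of is_levi_civita])
  from is_levi_civita_unique[OF this is_levi_civita_proj_connection assms] show ?thesis
    by (simp add: proj_connection_def)
qed


section \<open>The covariant derivative along a curve\<close>

lemma velocity_works:
  assumes "c C1_differentiable_on UNIV"
  shows "(c has_vector_derivative velocity c t) (at t)"
  using assms by (auto simp: velocity_def C1_differentiable_on_eq vector_derivative_works[symmetric])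

lemma velocityI: "(c has_vector_derivative d) (at t) \<Longrightarrow> velocity c t = d"
  by (simp add: velocity_def vector_derivative_at)

lemma C1_differentiable_on_inner:
  fixes f g :: "real \<Rightarrow> 'a::real_inner"
  assumes "f C1_differentiable_on S" "g C1_differentiable_on S"
  shows "(\<lambda>s. f s \<bullet> g s) C1_differentiable_on S"
proof -
  obtain f' where f': "\<And>x. x \<in> S \<Longrightarrow> (f has_vector_derivative f' x) (at x)" "continuous_on S f'"
    using assms(1) unfolding C1_differentiable_on_def by blast
  obtain g' where g': "\<And>x. x \<in> S \<Longrightarrow> (g has_vector_derivative g' x) (at x)" "continuous_on S g'"
    using assms(2) unfolding C1_differentiable_on_def by blast
  have "((\<lambda>s. f s \<bullet> g s) has_vector_derivative f x \<bullet> g' x + f' x \<bullet> g x) (at x)" if "x \<in> S" for x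
    using that f'(1) g'(1)
    by (intro bounded_bilinear.has_vector_derivative[OF bounded_bilinear_inner])
  moreover have "continuous_on S (\<lambda>x. f x \<bullet> g' x + f' x \<bullet> g x)"
    using f'(2) g'(2) assms[THEN C1_differentiable_imp_continuous_on]
    by (intro continuous_on_add continuous_on_inner)
  ultimately show ?thesis
    unfolding C1_differentiable_on_def by (intro exI[of _ "\<lambda>x. f x \<bullet> g' x + f' x \<bullet> g x"]) simp
qed

lemma velocity_in_tangent_space:
  assumes "range \<gamma> \<subseteq> S3" "\<gamma> C1_differentiable_on UNIV"
  shows "velocity \<gamma> t \<in> tangent_space (\<gamma> t)"
proof -
  have "((\<lambda>s. \<gamma> s \<bullet> \<gamma> s) has_vector_derivative \<gamma> t \<bullet> velocity \<gamma> t + velocity \<gamma> t \<bullet> \<gamma> t) (at t)"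
    using velocity_works[OF assms(2)]
    by (intro bounded_bilinear.has_vector_derivative[OF bounded_bilinear_inner])
  moreover have "(\<lambda>s. \<gamma> s \<bullet> \<gamma> s) = (\<lambda>s. 1)"
    using assms(1) inner_self_S3 by blast
  ultimately have "\<gamma> t \<bullet> velocity \<gamma> t + velocity \<gamma> t \<bullet> \<gamma> t = 0"
    using vector_derivative_unique_at[OF _ has_vector_derivative_const] by metis
  then show ?thesis by (simp add: tangent_space_def inner_commute)
qed

lemma velocity_vector_field_compose:
  assumes "vector_field Y" "range \<gamma> \<subseteq> S3" "\<gamma> C1_differentiable_on UNIV"
  shows "velocity (Y \<circ> \<gamma>) t = dir_deriv Y (\<gamma> t) (velocity \<gamma> t)"
proof -
  have "(Y has_derivative frechet_derivative Y (at (\<gamma> t) within S3)) (at (\<gamma> t) within S3)"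
    using assms by (intro smooth_on_S3_has_derivative) (auto simp: vector_field_def)
  from has_vector_derivative_compose_S3[OF this assms(2) velocity_works[OF assms(3)]]
  show ?thesis by (auto simp: dir_deriv_def o_def intro: velocityI)
qed

text \<open>Existence of the covariant derivative. Compatibility with \<open>levi_civita\<close> is
  the chain rule for \<open>Y \<circ> \<gamma>\<close>, into which \<open>X\<close> enters only
  through its value at \<open>\<gamma> t\<close>.\<close>

lemma is_cov_deriv_along_tan_proj:
  assumes "range \<gamma> \<subseteq> S3" "\<gamma> C1_differentiable_on UNIV"
  shows "is_cov_deriv_along levi_civita \<gamma> (\<lambda>W t. tan_proj (\<gamma> t) (velocity W t))"
  unfolding is_cov_deriv_along_def
proof (intro conjI allI impI)
  fix W t
  show "tan_proj (\<gamma> t) (velocity W t) \<in> tangent_space (\<gamma> t)"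
    using assms(1) by (intro tan_proj_in_tangent_space) auto
next
  fix W W' t assume "vector_field_along \<gamma> W" "vector_field_along \<gamma> W'"
  then have "((\<lambda>s. W s + W' s) has_vector_derivative velocity W t + velocity W' t) (at t)"
    by (intro has_vector_derivative_add velocity_works) (auto simp: vector_field_along_def)
  then show "tan_proj (\<gamma> t) (velocity (\<lambda>s. W s + W' s) t) =
      tan_proj (\<gamma> t) (velocity W t) + tan_proj (\<gamma> t) (velocity W' t)"
    by (simp add: velocityI tan_proj_add)
next
  fix f :: "real \<Rightarrow> real" and W t
  assume f: "f C1_differentiable_on UNIV" and W: "vector_field_along \<gamma> W"
  obtain d where d: "(f has_real_derivative d) (at t)"
    using f unfolding C1_differentiable_on_def has_real_derivative_iff_has_vector_derivative by blast
  then have "((\<lambda>s. f s *\<^sub>R W s) has_vector_derivative f t *\<^sub>R velocity W t + d *\<^sub>R W t) (at t)"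
    using W by (intro has_vector_derivative_scaleR velocity_works) (auto simp: vector_field_along_def)
  moreover have "tan_proj (\<gamma> t) (W t) = W t"
    using W tan_proj_id by (auto simp: vector_field_along_def)
  ultimately show "tan_proj (\<gamma> t) (velocity (\<lambda>s. f s *\<^sub>R W s) t) =
      deriv f t *\<^sub>R W t + f t *\<^sub>R tan_proj (\<gamma> t) (velocity W t)"
    using d by (simp add: velocityI DERIV_imp_deriv tan_proj_add tan_proj_scaleR)
next
  fix X Y t assume *: "vector_field X" "vector_field Y" "X (\<gamma> t) = velocity \<gamma> t"
  have "\<gamma> t \<in> S3" using assms(1) by auto
  with * show "tan_proj (\<gamma> t) (velocity (Y \<circ> \<gamma>) t) = levi_civita X Y (\<gamma> t)"
    by (simp add: levi_civita_eq velocity_vector_field_compose assms)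
qed

lemma vector_field_along_scaleR:
  assumes "f C1_differentiable_on UNIV" "vector_field_along \<gamma> W"
  shows "vector_field_along \<gamma> (\<lambda>s. f s *\<^sub>R W s)"
  using assms by (auto simp: vector_field_along_def tangent_space_def)

lemma vector_field_along_sum:
  assumes "\<And>i. i \<in> I \<Longrightarrow> vector_field_along \<gamma> (W i)"
  shows "vector_field_along \<gamma> (\<lambda>s. \<Sum>i\<in>I. W i s)"
  using assms
  by (induction I rule: infinite_finite_induct)
    (auto simp: vector_field_along_def tangent_space_def inner_simps)

lemma is_cov_deriv_along_sum:
  assumes D: "is_cov_deriv_along nabla \<gamma> D"
    and "finite I" and "\<And>i. i \<in> I \<Longrightarrow> vector_field_along \<gamma> (W i)"
  shows "D (\<lambda>s. \<Sum>i\<in>I. W i s) t = (\<Sum>i\<in>I. D (W i) t)"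
  using assms(2,3)
proof (induction I rule: finite_induct)
  case empty
  have "vector_field_along \<gamma> (\<lambda>_. 0)"
    by (simp add: vector_field_along_def tangent_space_def)
  \<comment> \<open>Additivity alone gives \<open>D 0 = D 0 + D 0\<close>, so the empty sum is sent
    to zero.\<close>
  with D have "D (\<lambda>s. 0 + 0) t = D (\<lambda>_. 0) t + D (\<lambda>_. 0) t"
    unfolding is_cov_deriv_along_def by blast
  then show ?case by simp
next
  case (insert i I)
  then have "D (\<lambda>s. W i s + (\<Sum>i\<in>I. W i s)) t = D (W i) t + D (\<lambda>s. \<Sum>i\<in>I. W i s) t"
    using D vector_field_along_sum[of I \<gamma> W] unfolding is_cov_deriv_along_def by blast
  with insert show ?case by simp
qed

text \<open>
  The tangential parts of the constant fields \<open>b \<in> Basis\<close> span every tangent space, with the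
  components \<open>W t \<bullet> b\<close> as coefficients, so that no local frames or cut-off functions are needed.
\<close>

lemma is_cov_deriv_along_unique:
  assumes \<gamma>: "range \<gamma> \<subseteq> S3" "\<gamma> C1_differentiable_on UNIV"
    and D: "is_cov_deriv_along nabla \<gamma> D" and D': "is_cov_deriv_along nabla \<gamma> D'"
    and W: "vector_field_along \<gamma> W"
  shows "D W t = D' W t"
proof -
  have vf: "vector_field (\<lambda>q. tan_proj q b)" for b
    by (rule vector_field_tan_proj) (simp add: smooth_on_S3_def)
  define E where "E = (\<lambda>b s. tan_proj (\<gamma> s) b)"
  have E: "vector_field_along \<gamma> (E b)" for b
    using \<gamma> unfolding vector_field_along_def
    by (auto simp: E_def tan_proj_def intro!: C1_differentiable_on_diff C1_differentiable_on_scaleR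
        C1_differentiable_on_inner tan_proj_in_tangent_space[unfolded tan_proj_def])
  have coeff: "(\<lambda>s. W s \<bullet> b) C1_differentiable_on UNIV" for b
    using W by (intro C1_differentiable_on_inner) (auto simp: vector_field_along_def)
  have W_eq: "W = (\<lambda>s. \<Sum>b\<in>Basis. (W s \<bullet> b) *\<^sub>R E b s)"
  proof
    fix s
    \<comment> \<open>The basis expansion of \<open>W s\<close> is projected termwise;
      \<open>W s\<close> itself is fixed, being tangent.\<close>
    have "tan_proj (\<gamma> s) (\<Sum>b\<in>Basis. (W s \<bullet> b) *\<^sub>R b) = (\<Sum>b\<in>Basis. (W s \<bullet> b) *\<^sub>R E b s)"
      unfolding E_def
      by (subst linear_sum[where f = "tan_proj (\<gamma> s)"])
        (auto simp: tan_proj_scaleR intro!: linearI tan_proj_add)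
    then show "W s = (\<Sum>b\<in>Basis. (W s \<bullet> b) *\<^sub>R E b s)"
      using W by (simp add: euclidean_representation tan_proj_id vector_field_along_def)
  qed
  \<comment> \<open>The right-hand side does not mention \<open>D\<close>, so it determines the
    operator.\<close>
  have expand: "D W t = (\<Sum>b\<in>Basis. deriv (\<lambda>s. W s \<bullet> b) t *\<^sub>R E b t + (W t \<bullet> b) *\<^sub>R
      nabla (\<lambda>q. tan_proj q (velocity \<gamma> t)) (\<lambda>q. tan_proj q b) (\<gamma> t))"
    if D: "is_cov_deriv_along nabla \<gamma> D" for D
  proof -
    \<comment> \<open>The field \<open>X\<close> has to match the velocity only at the single time
      \<open>t\<close>, so the projection of the constant vector \<open>velocity \<gamma> t\<close>
      is a global extension.\<close>
    have DE: "D (E b) t = nabla (\<lambda>q. tan_proj q (velocity \<gamma> t)) (\<lambda>q. tan_proj q b) (\<gamma> t)" for b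
    proof -
      have "E b = (\<lambda>q. tan_proj q b) \<circ> \<gamma>" by (auto simp: E_def)
      moreover have "tan_proj (\<gamma> t) (velocity \<gamma> t) = velocity \<gamma> t"
        using velocity_in_tangent_space[OF \<gamma>] tan_proj_id by blast
      ultimately show ?thesis
        using D vf unfolding is_cov_deriv_along_def by simp
    qed
    have "D W t = D (\<lambda>s. \<Sum>b\<in>Basis. (W s \<bullet> b) *\<^sub>R E b s) t"
      using W_eq by simp
    also have "\<dots> = (\<Sum>b\<in>Basis. D (\<lambda>s. (W s \<bullet> b) *\<^sub>R E b s) t)"
      using D by (rule is_cov_deriv_along_sum) (auto intro: vector_field_along_scaleR coeff E)
    also have "\<dots> = (\<Sum>b\<in>Basis. deriv (\<lambda>s. W s \<bullet> b) t *\<^sub>R E b t + (W t \<bullet> b) *\<^sub>R D (E b) t)"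
      using D coeff E unfolding is_cov_deriv_along_def by (intro sum.cong) blast+
    finally show ?thesis by (simp only: DE)
  qed
  show ?thesis using expand[OF D] expand[OF D'] by simp
qed

lemma cov_deriv_along_eq:
  assumes "range \<gamma> \<subseteq> S3" "\<gamma> C1_differentiable_on UNIV" "vector_field_along \<gamma> W"
  shows "cov_deriv_along \<gamma> W t = tan_proj (\<gamma> t) (velocity W t)"
proof -
  note tp = is_cov_deriv_along_tan_proj[OF assms(1,2)]
  have "is_cov_deriv_along levi_civita \<gamma> (cov_deriv_along \<gamma>)"
    unfolding cov_deriv_along_def using tp by (rule someI[of "is_cov_deriv_along levi_civita \<gamma>"])
  from is_cov_deriv_along_unique[OF assms(1,2) this tp assms(3)] show ?thesis .
qed


section \<open>Rotated great circles\<close>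

text \<open>On each coordinate the real inner product is scaled by the squared modulus of
  \<open>a\<close>.\<close>

lemma inner_smult_unit:
  fixes x y :: "complex^'n"
  assumes "norm a = 1"
  shows "(a *s x) \<bullet> (a *s y) = x \<bullet> y"
proof -
  have "(a * z) \<bullet> (a * w) = z \<bullet> w" for z w :: complex
  proof -
    have "(Re a)^2 + (Im a)^2 = 1"
      using assms by (simp add: norm_complex_def)
    moreover have "(a * z) \<bullet> (a * w) = ((Re a)^2 + (Im a)^2) * (z \<bullet> w)"
      by (simp add: inner_complex_def power2_eq_square algebra_simps)
    ultimately show ?thesis by simp
  qed
  then show ?thesis by (simp add: inner_vec_def)
qed

text \<open>Multiplication by \<open>\<i>\<close> is skew-adjoint for the real inner
  product.\<close>

lemma inner_i_smult_left:
  fixes x y :: "complex^'n"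
  shows "(\<i> *s x) \<bullet> y = - (x \<bullet> (\<i> *s y))"
  by (simp add: inner_vec_def inner_complex_def sum_negf[symmetric] algebra_simps)

lemma inner_i_smult_self: "x \<bullet> (\<i> *s x) = 0" for x :: "complex^'n"
  using inner_i_smult_left[of x x] by (simp add: inner_commute)

text \<open>Real bilinearity suffices, since boundedness is automatic in finite dimension. This
  gives the product rule for a complex factor times a curve.\<close>

lemma bounded_bilinear_smult: "bounded_bilinear ((*s) :: complex \<Rightarrow> complex^'n \<Rightarrow> complex^'n)"
proof -
  have "bilinear ((*s) :: complex \<Rightarrow> complex^'n \<Rightarrow> complex^'n)"
    unfolding bilinear_def by (auto intro!: linearI simp: vec_eq_iff algebra_simps)
  then show ?thesis by (simp add: bilinear_conv_bounded_bilinear)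
qed

text \<open>Stated for an arbitrary curve so that one derivative formula applies twice: the velocity
  of a rotated curve is again a rotated curve with the same \<open>m\<close>.\<close>

definition rotate_curve :: "real \<Rightarrow> (real \<Rightarrow> complex^2) \<Rightarrow> real \<Rightarrow> complex^2"
  where "rotate_curve m c t = exp (- \<i> * complex_of_real (m * t)) *s c t"

lemma has_vector_derivative_rotate_curve:
  assumes "(c has_vector_derivative d) (at t)"
  shows "(rotate_curve m c has_vector_derivative
    exp (- \<i> * complex_of_real (m * t)) *s (d - m *\<^sub>R (\<i> *s c t))) (at t)"
proof -
  have "((\<lambda>z. exp (- \<i> * complex_of_real m * z)) has_field_derivative
      exp (- \<i> * complex_of_real m * t) * (- \<i> * complex_of_real m)) (at (complex_of_real t))"
    by (auto intro!: derivative_eq_intros)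
  from has_vector_derivative_real_field[OF this]
  have "((\<lambda>s. exp (- \<i> * complex_of_real (m * s))) has_vector_derivative
      exp (- \<i> * complex_of_real (m * t)) * (- \<i> * complex_of_real m)) (at t)"
    by (simp add: mult.assoc)
  from bounded_bilinear.has_vector_derivative[OF bounded_bilinear_smult this assms]
  show ?thesis
    unfolding rotate_curve_def[abs_def]
    by (rule has_vector_derivative_eq_rhs) (simp add: vec_eq_iff scaleR_conv_of_real[where 'a = complex])
qed

lemma rotate_curve_inner:
  "(exp (- \<i> * complex_of_real r) *s x) \<bullet> (exp (- \<i> * complex_of_real r) *s y) = x \<bullet> y"
  for x y :: "complex^'n"
  by (rule inner_smult_unit) (simp add: norm_exp_eq_Re)

theorem proposition4:
  fixes p v :: "complex^2" and \<gamma>\<^sub>R \<gamma> :: "real \<Rightarrow> complex^2"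
  assumes "p \<in> S3"
    and "v \<in> tangent_space p"
    and "great_circle \<gamma>\<^sub>R"
    and "\<gamma>\<^sub>R 0 = p"
    and "velocity \<gamma>\<^sub>R 0 = v"
    and "\<And>t. \<gamma> t = exp (- \<i> * complex_of_real ((v \<bullet> V2 p) * t)) *s \<gamma>\<^sub>R t"
    and "arc_length_parameterized \<gamma>"
  shows "has_curvature \<gamma> (v \<bullet> V2 p)"
proof -
  define m where "m = v \<bullet> V2 p"
  define e where "e = (\<lambda>t. exp (- \<i> * complex_of_real (m * t)))"
  have e_inner: "(e t *s x) \<bullet> (e t *s y) = x \<bullet> y" for t and x y :: "complex^2"
    unfolding e_def by (rule rotate_curve_inner)
  obtain u w \<omega> where u: "norm u = 1" and w: "norm w = 1" and uw: "u \<bullet> w = 0"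
    and c: "\<And>t. \<gamma>\<^sub>R t = cos (\<omega> * t) *\<^sub>R u + sin (\<omega> * t) *\<^sub>R w"
    using assms(3) unfolding great_circle_def by blast
  define c' where "c' = (\<lambda>t. \<omega> *\<^sub>R (- sin (\<omega> * t) *\<^sub>R u + cos (\<omega> * t) *\<^sub>R w))"
  have dc: "(\<gamma>\<^sub>R has_vector_derivative c' t) (at t)" for t
    unfolding c[abs_def] c'_def
    by (auto intro!: derivative_eq_intros simp: algebra_simps)
  have dc': "(c' has_vector_derivative (- \<omega>\<^sup>2) *\<^sub>R \<gamma>\<^sub>R t) (at t)" for t
    unfolding c c'_def
    by (auto intro!: derivative_eq_intros simp: algebra_simps power2_eq_square)
  have uu: "u \<bullet> u = 1" and ww: "w \<bullet> w = 1" and wu: "w \<bullet> u = 0"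
    using u w uw by (auto simp: dot_square_norm inner_commute)
  have sc: "sin x * sin x + cos x * cos x = 1" "cos x * cos x + sin x * sin x = 1" for x :: real
    using sin_cos_squared_add[of x] by (simp_all add: power2_eq_square)
  have cc: "\<gamma>\<^sub>R t \<bullet> \<gamma>\<^sub>R t = 1" for t
    by (simp add: c inner_simps uu ww uw wu sc)
  have p: "p = u" using assms(4) c[of 0] by simp
  have v: "v = \<omega> *\<^sub>R w" using assms(5) velocityI[OF dc, of 0] by (simp add: c'_def)
  \<comment> \<open>A conserved quantity of the great circle. By skewness
    \<open>u \<bullet> (\<i> *s w)\<close> and \<open>w \<bullet> (\<i> *s u)\<close> are opposite,
    so the mixed terms combine through \<open>sin\<^sup>2 + cos\<^sup>2 = 1\<close>; the initial
    data identify the value as \<open>m\<close>.\<close>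
  have c'ic: "c' t \<bullet> (\<i> *s \<gamma>\<^sub>R t) = m" for t
  proof -
    have i_lin: "\<i> *s (a *\<^sub>R x + b *\<^sub>R y) = a *\<^sub>R (\<i> *s x) + b *\<^sub>R (\<i> *s y)"
      for a b and x y :: "complex^2"
      by (simp add: vec_eq_iff algebra_simps)
    have "u \<bullet> (\<i> *s w) = - (w \<bullet> (\<i> *s u))"
      using inner_i_smult_left[of u w] by (simp add: inner_commute)
    then have "c' t \<bullet> (\<i> *s \<gamma>\<^sub>R t) =
        \<omega> * (w \<bullet> (\<i> *s u)) * (sin (\<omega> * t) * sin (\<omega> * t)) +
        \<omega> * (w \<bullet> (\<i> *s u)) * (cos (\<omega> * t) * cos (\<omega> * t))"
      unfolding c c'_def i_lin by (simp add: inner_simps inner_i_smult_self algebra_simps)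
    also have "\<dots> = \<omega> * (w \<bullet> (\<i> *s u))"
      by (simp add: sc flip: distrib_left)
    finally show ?thesis by (simp add: m_def p v V2_def)
  qed
  have \<gamma>: "\<gamma> = rotate_curve m \<gamma>\<^sub>R" and \<gamma>_e: "\<gamma> t = e t *s \<gamma>\<^sub>R t" for t
    using assms(6) by (auto simp: rotate_curve_def m_def e_def)
  \<comment> \<open>The horizontal part of \<open>c'\<close>: the component along the unit vector
    \<open>\<i> *s \<gamma>\<^sub>R t\<close> is removed.\<close>
  define h where "h = (\<lambda>t. c' t - m *\<^sub>R (\<i> *s \<gamma>\<^sub>R t))"
  define h' where "h' = (\<lambda>t. (- \<omega>\<^sup>2) *\<^sub>R \<gamma>\<^sub>R t - m *\<^sub>R (\<i> *s c' t))"
  have d\<gamma>: "(\<gamma> has_vector_derivative e t *s h t) (at t)" for t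
    unfolding \<gamma> h_def e_def by (rule has_vector_derivative_rotate_curve[OF dc])
  then have vel: "velocity \<gamma> = rotate_curve m h"
    by (auto simp: velocityI rotate_curve_def e_def)
  have vel_e: "velocity \<gamma> t = e t *s h t" for t
    using velocityI[OF d\<gamma>] .
  have bl_i: "bounded_linear ((*s) \<i> :: complex^2 \<Rightarrow> complex^2)"
    by (rule bounded_bilinear.bounded_linear_right[OF bounded_bilinear_smult])
  have dh: "(h has_vector_derivative h' t) (at t)" for t
    unfolding h_def h'_def
    by (intro has_vector_derivative_diff dc' dc bounded_linear.has_vector_derivative[OF bl_i]
        bounded_linear.has_vector_derivative[OF bounded_linear_scaleR_right])
  have d2\<gamma>: "(velocity \<gamma> has_vector_derivative e t *s (h' t - m *\<^sub>R (\<i> *s h t))) (at t)" for t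
    \<comment> \<open>Second use of the rotation formula, now with \<open>h\<close> in place of the
      great circle.\<close>
    unfolding vel e_def by (rule has_vector_derivative_rotate_curve[OF dh])
  have cont_e: "continuous_on UNIV e"
    unfolding e_def by (intro continuous_intros)
  have cont_c: "continuous_on UNIV \<gamma>\<^sub>R" and cont_c': "continuous_on UNIV c'"
    and cont_h: "continuous_on UNIV h"
    using dc dc' dh
    by (auto intro!: continuous_at_imp_continuous_on has_vector_derivative_continuous)
  note cont_smult = bounded_bilinear.continuous_on[OF bounded_bilinear_smult]
  have "continuous_on UNIV (\<lambda>t. e t *s h t)"
    by (intro cont_smult cont_e cont_h)
  with d\<gamma> have C1: "\<gamma> C1_differentiable_on UNIV"
    unfolding C1_differentiable_on_def by (intro exI[of _ "\<lambda>t. e t *s h t"]) simp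
  have "continuous_on UNIV (\<lambda>t. e t *s (h' t - m *\<^sub>R (\<i> *s h t)))"
    unfolding h'_def
    by (intro cont_smult cont_e continuous_intros cont_c cont_c' cont_h)
  with d2\<gamma> have C2: "velocity \<gamma> C1_differentiable_on UNIV"
    unfolding C1_differentiable_on_def
    by (intro exI[of _ "\<lambda>t. e t *s (h' t - m *\<^sub>R (\<i> *s h t))"]) simp
  have \<gamma>_S3: "range \<gamma> \<subseteq> S3"
    by (auto simp: S3_def norm_eq_1 \<gamma>_e e_inner cc)
  have tangent: "velocity \<gamma> t \<in> tangent_space (\<gamma> t)" for t
    using velocity_in_tangent_space[OF \<gamma>_S3 C1] .
  have h_ic: "h t \<bullet> (\<i> *s \<gamma>\<^sub>R t) = 0" for t
    using cc c'ic by (simp add: h_def inner_diff_left inner_smult_unit)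
  have horizontal: "horizontal_curve \<gamma>"
    unfolding horizontal_curve_def horizontal_space_def
  proof (intro allI CollectI conjI tangent)
    fix t
    have "V2 (\<gamma> t) = e t *s (\<i> *s \<gamma>\<^sub>R t)"
      by (simp add: V2_def \<gamma>_e vec_eq_iff)
    then show "velocity \<gamma> t \<bullet> V2 (\<gamma> t) = 0"
      by (simp only: vel_e e_inner h_ic)
  qed
  have curvature: "cov_deriv_along \<gamma> (velocity \<gamma>) t + (2 * m) *\<^sub>R J (velocity \<gamma> t) = 0" for t
  proof -
    define a where "a = h' t - m *\<^sub>R (\<i> *s h t)"
    \<comment> \<open>Substituting \<open>c' = h + m \<i> c\<close> in \<open>h'\<close> turns
      \<open>- m \<i> c'\<close> into \<open>- m \<i> h + m\<^sup>2 c\<close>; the other copy of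
      \<open>- m \<i> h\<close> comes from differentiating the rotation.\<close>
    have a: "a = (m\<^sup>2 - \<omega>\<^sup>2) *\<^sub>R \<gamma>\<^sub>R t - (2 * m) *\<^sub>R (\<i> *s h t)"
      by (simp add: a_def h_def h'_def vec_eq_iff scaleR_conv_of_real[where 'a = complex]
          algebra_simps power2_eq_square)
    \<comment> \<open>The term with \<open>\<i> *s h t\<close> is orthogonal to the position, by
      skewness and horizontality of \<open>h\<close>. The first summand of \<open>a\<close> is thus
      exactly its normal part.\<close>
    have "a \<bullet> \<gamma>\<^sub>R t = m\<^sup>2 - \<omega>\<^sup>2"
      unfolding a inner_diff_left inner_scaleR_left inner_i_smult_left h_ic by (simp add: cc)
    moreover have "velocity (velocity \<gamma>) t = e t *s a"
      by (simp only: velocityI[OF d2\<gamma>] a_def)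
    moreover have "vector_field_along \<gamma> (velocity \<gamma>)"
      using C2 tangent by (simp add: vector_field_along_def)
    \<comment> \<open>The factor \<open>e t\<close> is an isometry, so the normal component can be
      computed before rotating. Only \<open>- 2 m \<i>\<close> times the velocity survives the
      projection.\<close>
    ultimately have "cov_deriv_along \<gamma> (velocity \<gamma>) t = e t *s a - (m\<^sup>2 - \<omega>\<^sup>2) *\<^sub>R (e t *s \<gamma>\<^sub>R t)"
      by (simp only: cov_deriv_along_eq[OF \<gamma>_S3 C1] tan_proj_def \<gamma>_e e_inner)
    then show ?thesis
      by (simp add: a J_def vel_e vec_eq_iff scaleR_conv_of_real[where 'a = complex] algebra_simps)
  qed
  show ?thesis
    unfolding has_curvature_def C2_curve_in_S3_def
    using C1 C2 \<gamma>_S3 horizontal assms(7) curvature by (simp add: m_def)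
qed

end
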